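(* Let $p$ be a prime with $p\equiv\pm1\pmod 5$. Then, for every $n=0,1,2,\ldots$, $$\sum_{k=0}^{p-1}F_{2k}H_k^n\equiv\sum_{\substack{0\le k\le p-1\\ 2\mid k}}F_kH_k^n\equiv\sum_{\substack{0\le k\le p-1\\ 2\nmid k}}L_kH_k^n\equiv 0\pmod p.$$
   Context: For $n\in\{0,1,2,\ldots\}$, the harmonic number is $H_n=\sum_{0<j\le n}1/j$ (so $H_0=0$); $H_k^n$ denotes the $n$-th power $(H_k)^n$. $F_n$ and $L_n$ are the Fibonacci and Lucas numbers: $F_0=0$, $F_1=1$, $F_{n+1}=F_n+F_{n-1}$ for $n\ge 1$; $L_0=2$, $L_1=1$, $L_{n+1}=L_n+L_{n-1}$ for $n\ge 1$. A congruence $x\equiv y\pmod{p}$ between rational numbers means that $x-y\in p\,\mathbb{Z}_{(p)}$, where $\mathbb{Z}_{(p)}$ is the ring of rational numbers whose denominator (in lowest terms) is prime to $p$. *)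

theory Defs
  imports "HOL-Number_Theory.Number_Theory"
begin

(* The library's harmonic numbers (harm) live in real normed fields, which excludes rat. *)
definition harmonic :: "nat \<Rightarrow> rat" where
  "harmonic n = (\<Sum>j\<in>{0<..n}. 1 / of_nat j)"

fun lucas :: "nat \<Rightarrow> nat" where
  "lucas 0 = 2"
| "lucas (Suc 0) = 1"
| "lucas (Suc (Suc n)) = lucas (Suc n) + lucas n"

(* quotient_of yields the fraction in lowest terms, with positive denominator. *)
definition localized_ints :: "nat \<Rightarrow> rat set" where
  "localized_ints p = {x. coprime (snd (quotient_of x)) (int p)}"

definition rat_cong :: "rat \<Rightarrow> rat \<Rightarrow> nat \<Rightarrow> bool"  ("(1[_ = _] '(rmod _'))") where
  "[x = y] (rmod p) \<longleftrightarrow> x - y \<in> (\<lambda>z. of_nat p * z) ` localized_ints p"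

end

theory Submission
  imports Defs
begin

text \<open>
  All three sums vanish modulo \<open>p\<close> because the reflection \<open>k \<mapsto> p - 1 - k\<close> of the index range
  changes the sign of every term; it also preserves parity, as \<open>p - 1\<close> is even.  A sum \<open>S\<close> of
  such terms satisfies \<open>S \<equiv> - S\<close>, hence \<open>S \<equiv> 0\<close> for odd \<open>p\<close>
  (lemma \<open>sum_antisymmetric_rat_cong_0\<close>).

  The harmonic numbers are invariant under the reflection (lemma \<open>harmonic_reflect\<close>).  Indeed
  \<open>1 / j + 1 / (p - j) = p / (j * (p - j)) \<equiv> 0\<close>.  Pairing \<open>j\<close> with \<open>p - j\<close> therefore gives
  \<open>H\<^sub>p\<^sub>-\<^sub>1 \<equiv> 0 = H\<^sub>0\<close>, and when \<open>k\<close> grows by one, \<open>H\<^sub>k\<close> gains \<open>1 / (k + 1)\<close> while \<open>H\<^sub>p\<^sub>-\<^sub>1\<^sub>-\<^sub>k\<close> loses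
  \<open>1 / (p - (k + 1)) \<equiv> - 1 / (k + 1)\<close>, which is the same change.

  The sign comes from the Fibonacci and Lucas factors.  For \<open>p \<equiv> \<plusminus>1 (mod 5)\<close> quadratic reciprocity
  makes 5 a square modulo \<open>p\<close>, so \<open>X\<^sup>2 = X + 1\<close> has two distinct roots in the field with \<open>p\<close>
  elements.  By Fermat's theorem their powers have period \<open>p - 1\<close>, and therefore so has the
  Fibonacci sequence modulo \<open>p\<close> (lemma \<open>fib_period\<close>), and with it the Lucas sequence.  So the
  reflection acts as \<open>k \<mapsto> - k\<close> on indices; continued to negative indices, the two sequences satisfy
  \<open>F\<^sub>-\<^sub>k = - (-1)\<^sup>k F\<^sub>k\<close> and \<open>L\<^sub>-\<^sub>k = (-1)\<^sup>k L\<^sub>k\<close>.  Thus \<open>F\<^sub>2\<^sub>k\<close>, \<open>F\<^sub>k\<close> for even \<open>k\<close>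
  and \<open>L\<^sub>k\<close> for odd \<open>k\<close> all change sign (lemmas \<open>fib_reflect\<close> and \<open>lucas_reflect_odd\<close>).
\<close>


section \<open>Congruences between rational numbers\<close>

text \<open>
  Dropping the requirement of lowest terms is what makes closure under the ring operations easy.
\<close>

lemma localized_ints_iff:
  "x \<in> localized_ints p \<longleftrightarrow>
     (\<exists>a b. b \<noteq> 0 \<and> coprime b (int p) \<and> x = of_int a / of_int b)"
proof
  assume "x \<in> localized_ints p"
  moreover obtain a b where ab: "quotient_of x = (a, b)"
    by force
  ultimately have "b \<noteq> 0 \<and> coprime b (int p) \<and> x = of_int a / of_int b"
    using quotient_of_div[OF ab] quotient_of_denom_pos[OF ab] by (simp add: localized_ints_def)
  then show "\<exists>a b. b \<noteq> 0 \<and> coprime b (int p) \<and> x = of_int a / of_int b"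
    by blast
next
  assume "\<exists>a b. b \<noteq> 0 \<and> coprime b (int p) \<and> x = of_int a / of_int b"
  then obtain a b where b: "b \<noteq> 0" "coprime b (int p)" and x: "x = of_int a / of_int b"
    by blast
  obtain c d where cd: "quotient_of x = (c, d)"
    by force
  have "d > 0" "x = of_int c / of_int d" "coprime c d"
    using quotient_of_denom_pos[OF cd] quotient_of_div[OF cd] quotient_of_coprime[OF cd] by auto
  with b x have "(of_int (c * b) :: rat) = of_int (a * d)"
    by (simp add: field_simps)
  then have "c * b = a * d"
    by (simp only: of_int_eq_iff)
  then have "d dvd c * b"
    by simp
  then have "d dvd b"
    using \<open>coprime c d\<close> by (simp add: coprime_commute coprime_dvd_mult_right_iff)
  then have "coprime d (int p)"
    using b(2) by (meson coprime_divisors dvd_refl)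
  then show "x \<in> localized_ints p"
    by (simp add: localized_ints_def cd)
qed

lemma of_int_in_localized_ints: "of_int a \<in> localized_ints p"
  unfolding localized_ints_iff by (rule exI[of _ a], rule exI[of _ 1]) simp

lemma localized_ints_mult:
  assumes "x \<in> localized_ints p" "y \<in> localized_ints p"
  shows "x * y \<in> localized_ints p"
proof -
  obtain a b c d where "b \<noteq> 0" "coprime b (int p)" "x = of_int a / of_int b"
      "d \<noteq> 0" "coprime d (int p)" "y = of_int c / of_int d"
    using assms unfolding localized_ints_iff by blast
  then have "b * d \<noteq> 0 \<and> coprime (b * d) (int p) \<and> x * y = of_int (a * c) / of_int (b * d)"
    by simp
  then show ?thesis
    unfolding localized_ints_iff by blast
qed

lemma localized_ints_add:
  assumes "x \<in> localized_ints p" "y \<in> localized_ints p"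
  shows "x + y \<in> localized_ints p"
proof -
  obtain a b c d where "b \<noteq> 0" "coprime b (int p)" "x = of_int a / of_int b"
      "d \<noteq> 0" "coprime d (int p)" "y = of_int c / of_int d"
    using assms unfolding localized_ints_iff by blast
  then have "b * d \<noteq> 0 \<and> coprime (b * d) (int p) \<and>
      x + y = of_int (a * d + c * b) / of_int (b * d)"
    by (simp add: add_frac_eq)
  then show ?thesis
    unfolding localized_ints_iff by blast
qed

lemma localized_ints_uminus: "x \<in> localized_ints p \<Longrightarrow> - x \<in> localized_ints p"
  using localized_ints_mult[OF of_int_in_localized_ints[of "-1"]] by force

lemma localized_ints_sum:
  "(\<And>k. k \<in> A \<Longrightarrow> f k \<in> localized_ints p) \<Longrightarrow> sum f A \<in> localized_ints p"
  using of_int_in_localized_ints[of 0 p]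
  by (induction A rule: infinite_finite_induct) (auto intro: localized_ints_add)

lemma localized_ints_power: "x \<in> localized_ints p \<Longrightarrow> x ^ n \<in> localized_ints p"
  using of_int_in_localized_ints[of 1 p] by (induction n) (auto intro: localized_ints_mult)

lemma inverse_nat_in_localized_ints:
  assumes "prime p" "0 < j" "j < p"
  shows "1 / of_nat j \<in> localized_ints p"
proof -
  have "coprime (int j) (int p)"
    using assms by (metis coprime_commute coprime_int_iff nat_dvd_not_less prime_imp_coprime)
  with assms show ?thesis
    unfolding localized_ints_iff by (intro exI[of _ 1] exI[of _ "int j"]) simp
qed

lemma rat_cong_iff: "[x = y] (rmod p) \<longleftrightarrow> (\<exists>z\<in>localized_ints p. x = y + of_nat p * z)"
  unfolding rat_cong_def by (auto simp: image_iff algebra_simps)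

lemma rat_cong_refl: "[x = x] (rmod p)"
  using of_int_in_localized_ints[of 0 p] by (force simp: rat_cong_iff)

lemma rat_cong_sym: "[x = y] (rmod p) \<Longrightarrow> [y = x] (rmod p)"
  unfolding rat_cong_iff using localized_ints_uminus by force

lemma rat_cong_add:
  assumes "[x = y] (rmod p)" "[x' = y'] (rmod p)"
  shows "[x + x' = y + y'] (rmod p)"
proof -
  obtain z z' where "z \<in> localized_ints p" "z' \<in> localized_ints p"
      "x = y + of_nat p * z" "x' = y' + of_nat p * z'"
    using assms unfolding rat_cong_iff by blast
  then show ?thesis
    unfolding rat_cong_iff
    by (intro bexI[of _ "z + z'"]) (auto simp: algebra_simps intro: localized_ints_add)
qed

lemma rat_cong_trans: "[x = y] (rmod p) \<Longrightarrow> [y = z] (rmod p) \<Longrightarrow> [x = z] (rmod p)"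
  using rat_cong_add[of x y p "y - y" "z - y"] rat_cong_add[of y z p "- y" "- y"]
    rat_cong_refl[of "- y" p] by simp

lemma rat_cong_scale:
  assumes "[x = y] (rmod p)" "c \<in> localized_ints p"
  shows "[c * x = c * y] (rmod p)"
proof -
  obtain z where "z \<in> localized_ints p" "x = y + of_nat p * z"
    using assms unfolding rat_cong_iff by blast
  with assms show ?thesis
    unfolding rat_cong_iff
    by (intro bexI[of _ "c * z"]) (auto simp: algebra_simps intro: localized_ints_mult)
qed

lemma rat_cong_mult:
  assumes "[x = y] (rmod p)" "[x' = y'] (rmod p)" "y \<in> localized_ints p" "x' \<in> localized_ints p"
  shows "[x * x' = y * y'] (rmod p)"
  using rat_cong_trans[of "x * x'" "y * x'" p "y * y'"]
    rat_cong_scale[OF assms(1,4)] rat_cong_scale[OF assms(2,3)]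
  by (simp add: mult.commute)

lemma rat_cong_power:
  assumes "[x = y] (rmod p)" "x \<in> localized_ints p" "y \<in> localized_ints p"
  shows "[x ^ n = y ^ n] (rmod p)"
  by (induction n) (auto intro: rat_cong_refl rat_cong_mult localized_ints_power assms)

lemma rat_cong_sum:
  "(\<And>k. k \<in> A \<Longrightarrow> [f k = g k] (rmod p)) \<Longrightarrow> [sum f A = sum g A] (rmod p)"
  by (induction A rule: infinite_finite_induct) (auto intro: rat_cong_refl rat_cong_add)

lemma rat_cong_of_int:
  assumes "[a = b] (mod int p)"
  shows "[of_int a = of_int b] (rmod p)"
proof -
  obtain c where "a = b + int p * c"
    using assms by (metis cong_iff_lin cong_sym)
  then show ?thesis
    unfolding rat_cong_iff
    by (intro bexI[of _ "of_int c"]) (auto intro: of_int_in_localized_ints)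
qed

text \<open>
  Reindexing by the involution \<open>r\<close> gives \<open>2 S \<equiv> 0\<close>, and 2 is invertible modulo an odd \<open>p\<close>.
\<close>

lemma sum_antisymmetric_rat_cong_0:
  assumes "odd p" and r: "\<And>k. k \<in> A \<Longrightarrow> r k \<in> A" "\<And>k. k \<in> A \<Longrightarrow> r (r k) = k"
    and anti: "\<And>k. k \<in> A \<Longrightarrow> [f (r k) = - f k] (rmod p)"
  shows "[sum f A = 0] (rmod p)"
proof -
  have "sum f A = (\<Sum>k\<in>A. f (r k))"
    by (rule sum.reindex_bij_witness[of _ r r]) (use r in auto)
  then have "2 * sum f A = (\<Sum>k\<in>A. f (r k) + f k)"
    by (simp add: sum.distrib)
  moreover have "[f (r k) + f k = 0] (rmod p)" if "k \<in> A" for k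
    using rat_cong_add[OF anti[OF that] rat_cong_refl[of "f k"]] by simp
  then have "[(\<Sum>k\<in>A. f (r k) + f k) = (\<Sum>k\<in>A. 0)] (rmod p)"
    by (rule rat_cong_sum)
  ultimately have "[2 * sum f A = 0] (rmod p)"
    by simp
  moreover have "1 / 2 \<in> localized_ints p"
    unfolding localized_ints_iff using \<open>odd p\<close>
    by (intro exI[of _ 1] exI[of _ 2]) auto
  ultimately show ?thesis
    using rat_cong_scale[of "2 * sum f A" 0 p "1 / 2"] by simp
qed


section \<open>Harmonic numbers\<close>

lemma harmonic_0: "harmonic 0 = 0"
  by (simp add: harmonic_def)

lemma harmonic_Suc: "harmonic (Suc k) = harmonic k + 1 / of_nat (Suc k)"
  by (simp add: harmonic_def atLeastSucAtMost_greaterThanAtMost[symmetric])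

lemma harmonic_in_localized_ints:
  "prime p \<Longrightarrow> k < p \<Longrightarrow> harmonic k \<in> localized_ints p"
  unfolding harmonic_def
  by (intro localized_ints_sum inverse_nat_in_localized_ints) auto

lemma inverses_cancel_rat_cong:
  assumes "prime p" "0 < i" "0 < j" "i + j = p"
  shows "[1 / of_nat i + 1 / of_nat j = 0] (rmod p)"
proof -
  have "(1 / of_nat i :: rat) * (1 / of_nat j) \<in> localized_ints p"
    using assms by (intro localized_ints_mult inverse_nat_in_localized_ints) auto
  moreover have "(1 / of_nat i + 1 / of_nat j :: rat) =
      of_nat p * ((1 / of_nat i) * (1 / of_nat j))"
    using assms by (auto simp: field_simps)
  ultimately show ?thesis
    unfolding rat_cong_iff by (metis add.left_neutral)
qed

lemma harmonic_p_minus_1: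
  assumes "prime p" "odd p"
  shows "[harmonic (p - 1) = 0] (rmod p)"
  unfolding harmonic_def
proof (rule sum_antisymmetric_rat_cong_0[where r = "\<lambda>j. p - j"])
  fix j assume j: "j \<in> {0<..p - 1}"
  then have "[1 / of_nat (p - j) + 1 / of_nat j = 0] (rmod p)"
    using assms by (intro inverses_cancel_rat_cong) auto
  from rat_cong_add[OF this rat_cong_refl[of "- (1 / of_nat j)"]]
  show "[1 / of_nat (p - j) = - (1 / of_nat j)] (rmod p)"
    by simp
qed (use assms in auto)

lemma harmonic_reflect:
  assumes "prime p" "odd p" "k \<le> p - 1"
  shows "[harmonic (p - 1 - k) = harmonic k] (rmod p)"
  using \<open>k \<le> p - 1\<close>
proof (induction k)
  case 0
  then show ?case
    using harmonic_p_minus_1[OF assms(1,2)] by (simp add: harmonic_0)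
next
  case (Suc k)
  define m where "m = p - 1 - Suc k"
  have m: "p - 1 - k = Suc m" "Suc m + Suc k = p"
    using Suc.prems by (auto simp: m_def)
  have "[harmonic (Suc m) = harmonic k] (rmod p)"
    using Suc m by simp
  moreover have "[1 / of_nat (Suc m) + 1 / of_nat (Suc k) = 0] (rmod p)"
    using m assms(1) by (intro inverses_cancel_rat_cong) auto
  then have "[0 = 1 / of_nat (Suc m) + 1 / of_nat (Suc k)] (rmod p)"
    by (rule rat_cong_sym)
  ultimately have "[harmonic (Suc m) + (- (1 / of_nat (Suc m)) + 0) =
      harmonic k + (- (1 / of_nat (Suc m)) + (1 / of_nat (Suc m) + 1 / of_nat (Suc k)))] (rmod p)"
    by (intro rat_cong_add rat_cong_refl)
  then show ?case
    by (simp add: harmonic_Suc m_def)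
qed


section \<open>Fibonacci and Lucas numbers modulo a prime\<close>

text \<open>
  The law of quadratic reciprocity carries no sign here, as \<open>5 \<equiv> 1 (mod 4)\<close>.
\<close>

lemma five_is_square_mod:
  assumes "prime p" "p > 2" "[int p = 1] (mod 5) \<or> [int p = -1] (mod 5)"
  shows "\<exists>y. [y\<^sup>2 = 5] (mod int p)"
proof -
  have "p \<noteq> 5"
    using assms(3) by (auto simp: cong_def)
  \<comment> \<open>The nonzero squares modulo 5 are 1 and \<open>2\<^sup>2 = 4 \<equiv> - 1\<close>.\<close>
  have "[1\<^sup>2 = int p] (mod 5) \<or> [2\<^sup>2 = int p] (mod 5)"
    using assms(3) by (auto simp: cong_def)
  then have "QuadRes 5 (int p)"
    unfolding QuadRes_def by blast
  moreover have "\<not> [int p = 0] (mod 5)"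
    using assms(3) by (auto simp: cong_def)
  ultimately have "Legendre (int p) 5 = 1"
    by (simp add: Legendre_def)
  moreover have "Legendre (int p) (int 5) * Legendre (int 5) (int p) =
      (-1) ^ ((p - 1) div 2 * ((5 - 1) div 2))"
    using assms \<open>p \<noteq> 5\<close> by (intro Quadratic_Reciprocity) auto
  ultimately have "Legendre 5 (int p) = 1"
    by simp
  then show ?thesis
    by (auto simp: Legendre_def QuadRes_def split: if_splits)
qed

text \<open>
  The root is \<open>(1 + y) / 2\<close>, where \<open>y\<close> is a square root of 5 modulo \<open>p\<close>.
\<close>

lemma golden_root_mod:
  assumes "prime p" "odd p" "[y\<^sup>2 = 5] (mod int p)"
  shows "\<exists>a. [a\<^sup>2 = a + 1] (mod int p) \<and> [2 * a - 1 = y] (mod int p)"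
proof -
  \<comment> \<open>Of \<open>y\<close> and \<open>y + p\<close> one is odd, which makes the halving exact.\<close>
  define z where "z = (if odd y then y else y + int p)"
  have "odd z" and zy: "[z = y] (mod int p)"
    using \<open>odd p\<close> by (auto simp: z_def cong_def)
  then obtain b where b: "z = 2 * b + 1"
    by (auto elim: oddE)
  have "[z\<^sup>2 = 5] (mod int p)"
    using zy assms(3) by (meson cong_pow cong_trans)
  moreover have "z\<^sup>2 - 5 = 4 * ((b + 1)\<^sup>2 - ((b + 1) + 1))"
    unfolding b by (simp add: power2_eq_square algebra_simps)
  ultimately have "int p dvd 2 ^ 2 * ((b + 1)\<^sup>2 - ((b + 1) + 1))"
    by (simp add: cong_iff_dvd_diff)
  moreover have "coprime (int p) (2 ^ 2)"
    using \<open>odd p\<close> by (simp only: coprime_power_right_iff coprime_right_2_iff_odd) simp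
  ultimately have "[(b + 1)\<^sup>2 = (b + 1) + 1] (mod int p)"
    by (simp only: coprime_dvd_mult_right_iff cong_iff_dvd_diff)
  moreover have "2 * (b + 1) - 1 = z"
    using b by simp
  ultimately show ?thesis
    using zy by blast
qed

text \<open>
  Holding for each root of \<open>X\<^sup>2 = X + 1\<close> separately, this plays the role of Binet's formula.
\<close>

lemma golden_power_mod:
  assumes "[a\<^sup>2 = a + 1] (mod int p)"
  shows "[a ^ Suc n = int (fib (Suc n)) * a + int (fib n)] (mod int p)"
proof (induction n)
  case (Suc n)
  have "[a * a ^ Suc n = a * (int (fib (Suc n)) * a + int (fib n))] (mod int p)"
    by (rule cong_scalar_left[OF Suc])
  also have "a * (int (fib (Suc n)) * a + int (fib n)) =
      int (fib (Suc n)) * a\<^sup>2 + int (fib n) * a"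
    by (simp add: power2_eq_square algebra_simps)
  also have "[int (fib (Suc n)) * a\<^sup>2 + int (fib n) * a =
      int (fib (Suc n)) * (a + 1) + int (fib n) * a] (mod int p)"
    by (intro cong_add cong_scalar_left assms cong_refl)
  also have "int (fib (Suc n)) * (a + 1) + int (fib n) * a =
      int (fib (Suc (Suc n))) * a + int (fib (Suc n))"
    by (simp add: algebra_simps)
  finally show ?case
    by simp
qed auto

lemma fermat_theorem_int:
  assumes "prime p" "\<not> int p dvd a"
  shows "[a ^ (p - 1) = 1] (mod int p)"
proof -
  define b where "b = nat (a mod int p)"
  have b: "int b = a mod int p"
    using assms(1) by (simp add: b_def prime_gt_0_nat)
  then have "\<not> p dvd b"
    using assms(2) by (metis dvd_mod_iff dvd_refl int_dvd_int_iff)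
  then have "[int b ^ (p - 1) = 1] (mod int p)"
    using fermat_theorem[OF assms(1)] by (metis cong_int_iff of_nat_1 of_nat_power)
  moreover have "[int b = a] (mod int p)"
    by (simp add: b)
  ultimately show ?thesis
    by (meson cong_pow cong_sym cong_trans)
qed

lemma golden_power_period:
  assumes "prime p" "[a\<^sup>2 = a + 1] (mod int p)" "p - 1 dvd N"
  shows "[a ^ N = 1] (mod int p)"
proof -
  have "\<not> int p dvd a"
  proof
    assume "int p dvd a"
    then have "int p dvd a\<^sup>2 - a"
      by (simp add: power2_eq_square)
    moreover have "int p dvd (a\<^sup>2 - a) - 1"
      using assms(2) by (simp add: cong_iff_dvd_diff diff_diff_eq)
    ultimately have "int p dvd 1"
      by (metis dvd_diff_right_iff)
    with assms(1) show False
      by auto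
  qed
  then have "[(a ^ (p - 1)) ^ (N div (p - 1)) = 1 ^ (N div (p - 1))] (mod int p)"
    by (intro cong_pow fermat_theorem_int assms)
  with assms(3) show ?thesis
    by (simp flip: power_mult)
qed

text \<open>
  Both roots \<open>a\<close> and \<open>1 - a\<close> of \<open>X\<^sup>2 = X + 1\<close> satisfy \<open>1 \<equiv> X\<^sup>N \<equiv> F\<^sub>N X + F\<^sub>N\<^sub>-\<^sub>1\<close>.  Since they are
  distinct modulo \<open>p\<close>, this forces \<open>F\<^sub>N \<equiv> 0\<close> and \<open>F\<^sub>N\<^sub>-\<^sub>1 \<equiv> 1\<close>.
\<close>

lemma fib_period:
  assumes "prime p" "odd p" "[int p = 1] (mod 5) \<or> [int p = -1] (mod 5)"
    and "p - 1 dvd N" "N > 0"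
  shows "[int (fib N) = 0] (mod int p)" "[int (fib (N - 1)) = 1] (mod int p)"
proof -
  have "p > 2"
    using assms(1,2) by (metis even_numeral le_neq_implies_less prime_ge_2_nat)
  then obtain y where y: "[y\<^sup>2 = 5] (mod int p)"
    using five_is_square_mod assms by blast
  then obtain a where a: "[a\<^sup>2 = a + 1] (mod int p)" "[2 * a - 1 = y] (mod int p)"
    using golden_root_mod assms by blast
  have "a\<^sup>2 - (a + 1) = (1 - a)\<^sup>2 - ((1 - a) + 1)"
    by (simp add: power2_eq_square algebra_simps)
  with a(1) have a': "[(1 - a)\<^sup>2 = (1 - a) + 1] (mod int p)"
    by (simp add: cong_iff_dvd_diff)
  have lin: "[int (fib N) * x + int (fib (N - 1)) = 1] (mod int p)"
    if "[x\<^sup>2 = x + 1] (mod int p)" for x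
    using golden_power_mod[OF that, of "N - 1"] golden_power_period[OF assms(1) that assms(4)]
      \<open>N > 0\<close> by (simp del: power_Suc) (meson cong_sym cong_trans)
  have "[int (fib N) * a + int (fib (N - 1)) - (int (fib N) * (1 - a) + int (fib (N - 1))) = 1 - 1]
      (mod int p)"
    by (intro cong_diff lin a a')
  then have "[int (fib N) * (2 * a - 1) = 0] (mod int p)"
    by (simp add: algebra_simps)
  moreover have "[int (fib N) * (2 * a - 1) = int (fib N) * y] (mod int p)"
    by (rule cong_scalar_left[OF a(2)])
  ultimately have "int p dvd int (fib N) * y"
    by (metis cong_0_iff cong_sym cong_trans)
  moreover have "\<not> int p dvd y"
  proof
    assume "int p dvd y"
    then have "int p dvd 5"
      using y by (metis cong_dvd_iff dvd_power pos2 dvd_trans)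
    then have "p dvd 5"
      by (metis int_dvd_int_iff of_nat_numeral)
    then have "p = 5"
      using assms(1) primes_dvd_imp_eq[of p 5] by simp
    with assms(3) show False
      by (simp add: cong_def)
  qed
  ultimately have "int p dvd int (fib N)"
    using assms(1) by (simp add: prime_dvd_mult_iff)
  then show F0: "[int (fib N) = 0] (mod int p)"
    by (simp add: cong_0_iff)
  have "[0 * a + int (fib (N - 1)) = int (fib N) * a + int (fib (N - 1))] (mod int p)"
    using F0 by (intro cong_add cong_mult cong_refl) (rule cong_sym)
  then show "[int (fib (N - 1)) = 1] (mod int p)"
    using lin[OF a(1)] by (simp) (meson cong_trans)
qed

text \<open>
  The hypotheses say that \<open>N\<close> is a period, so that \<open>F\<^sub>N\<^sub>-\<^sub>k\<close> stands for \<open>F\<^sub>-\<^sub>k\<close>; running the recurrence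
  backwards from \<open>F\<^sub>0 = 0\<close> and \<open>F\<^sub>-\<^sub>1 = 1\<close> produces the alternating signs.  A general \<open>N\<close> serves both
  the period \<open>p - 1\<close> and, for the terms \<open>F\<^sub>2\<^sub>k\<close> with \<open>k\<close> up to \<open>p - 1\<close>, its double.
\<close>

lemma fib_reflect:
  assumes "[int (fib N) = 0] (mod m)" "[int (fib (N - 1)) = 1] (mod m)" "k \<le> N"
  shows "[int (fib (N - k)) = - ((-1) ^ k * int (fib k))] (mod m)"
  using \<open>k \<le> N\<close>
proof (induction k rule: fib.induct)
  case (3 k)
  define l where "l = N - Suc (Suc k)"
  have l: "N - Suc k = Suc l" "N - k = Suc (Suc l)"
    using 3 by (auto simp: l_def)
  have "int (fib l) = int (fib (N - k)) - int (fib (N - Suc k))"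
    by (simp add: l)
  moreover have "[int (fib (N - k)) - int (fib (N - Suc k)) =
      - ((-1) ^ k * int (fib k)) - (- ((-1) ^ Suc k * int (fib (Suc k))))] (mod m)"
    using 3 by (intro cong_diff) auto
  ultimately have "[int (fib l) = - ((-1) ^ k * int (fib k)) -
      (- ((-1) ^ Suc k * int (fib (Suc k))))] (mod m)"
    by (simp only:)
  then show ?case
    by (simp add: algebra_simps flip: l_def)
qed (use assms in auto)

lemma lucas_eq_fib: "int (lucas k) = 2 * int (fib (Suc k)) - int (fib k)"
  by (induction k rule: lucas.induct) auto

lemma lucas_reflect_odd:
  assumes "[int (fib N) = 0] (mod m)" "[int (fib (N - 1)) = 1] (mod m)" "k \<le> N" "odd k"
  shows "[int (lucas (N - k)) = - int (lucas k)] (mod m)"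
proof -
  obtain j where k: "k = Suc j"
    using \<open>odd k\<close> by (cases k) auto
  have "even j" "Suc (N - k) = N - j"
    using assms k by auto
  then have "int (lucas (N - k)) = 2 * int (fib (N - j)) - int (fib (N - k))"
    by (simp add: lucas_eq_fib)
  also have "[\<dots> = 2 * - ((-1) ^ j * int (fib j)) - - ((-1) ^ k * int (fib k))] (mod m)"
    using assms k by (intro cong_diff cong_scalar_left fib_reflect) auto
  also have "2 * - ((-1) ^ j * int (fib j)) - - ((-1) ^ k * int (fib k)) = - int (lucas k)"
    using \<open>even j\<close> by (simp add: k lucas_eq_fib)
  finally show ?thesis .
qed


section \<open>The three sums\<close>

lemma reflected_harmonic_sum_cong_0:
  fixes c :: "nat \<Rightarrow> nat"
  assumes "prime p" "odd p" "A \<subseteq> {0..p - 1}" "\<And>k. k \<in> A \<Longrightarrow> p - 1 - k \<in> A"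
    and "\<And>k. k \<in> A \<Longrightarrow> [int (c (p - 1 - k)) = - int (c k)] (mod int p)"
  shows "[(\<Sum>k\<in>A. of_nat (c k) * harmonic k ^ n) = 0] (rmod p)"
proof (rule sum_antisymmetric_rat_cong_0[where r = "\<lambda>k. p - 1 - k"])
  fix k assume "k \<in> A"
  then have k: "k \<le> p - 1" "k < p"
    using subsetD[OF assms(3)] prime_gt_0_nat[OF assms(1)] by fastforce+
  have H: "harmonic k \<in> localized_ints p" "harmonic (p - 1 - k) \<in> localized_ints p"
    using harmonic_in_localized_ints[OF assms(1)] k by auto
  have "[of_int (int (c (p - 1 - k))) * harmonic (p - 1 - k) ^ n =
      of_int (- int (c k)) * harmonic k ^ n] (rmod p)"
    by (intro rat_cong_mult rat_cong_of_int assms(5) \<open>k \<in> A\<close> rat_cong_power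
        harmonic_reflect assms(1,2) k H of_int_in_localized_ints localized_ints_power)
  then show "[of_nat (c (p - 1 - k)) * harmonic (p - 1 - k) ^ n =
      - (of_nat (c k) * harmonic k ^ n)] (rmod p)"
    by simp
  show "p - 1 - (p - 1 - k) = k"
    using k by simp
qed (fact assms(2), fact assms(4))

theorem corollary1p3:
  fixes p n :: nat
  assumes "prime p"
    and "[int p = 1] (mod 5) \<or> [int p = -1] (mod 5)"
  shows "[(\<Sum>k\<in>{0..p - 1}. of_nat (fib (2 * k)) * harmonic k ^ n)
           = (\<Sum>k | k \<in> {0..p - 1} \<and> even k. of_nat (fib k) * harmonic k ^ n)] (rmod p)
       \<and> [(\<Sum>k | k \<in> {0..p - 1} \<and> even k. of_nat (fib k) * harmonic k ^ n)
           = (\<Sum>k | k \<in> {0..p - 1} \<and> odd k. of_nat (lucas k) * harmonic k ^ n)] (rmod p)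
       \<and> [(\<Sum>k | k \<in> {0..p - 1} \<and> odd k. of_nat (lucas k) * harmonic k ^ n) = 0] (rmod p)"
proof -
  have "p \<noteq> 2"
    using assms(2) by (auto simp: cong_def)
  then have "odd p"
    using assms(1) primes_dvd_imp_eq two_is_prime_nat by blast
  have "p > 1"
    using assms(1) by (rule prime_gt_1_nat)
  note period = fib_period[OF assms(1) \<open>odd p\<close> assms(2)]
  have F1: "[int (fib (p - 1)) = 0] (mod int p)" "[int (fib (p - 1 - 1)) = 1] (mod int p)"
    using period[of "p - 1"] \<open>p > 1\<close> by auto
  have F2: "[int (fib (2 * (p - 1))) = 0] (mod int p)"
      "[int (fib (2 * (p - 1) - 1)) = 1] (mod int p)"
    using period[of "2 * (p - 1)"] \<open>p > 1\<close> by auto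
  have "[(\<Sum>k\<in>{0..p - 1}. of_nat (fib (2 * k)) * harmonic k ^ n) = 0] (rmod p)"
  proof (rule reflected_harmonic_sum_cong_0[OF assms(1) \<open>odd p\<close>])
    fix k assume "k \<in> {0..p - 1}"
    then show "[int (fib (2 * (p - 1 - k))) = - int (fib (2 * k))] (mod int p)"
      using fib_reflect[OF F2, of "2 * k"] by (simp add: diff_mult_distrib2)
  qed auto
  moreover have "[(\<Sum>k | k \<in> {0..p - 1} \<and> even k. of_nat (fib k) * harmonic k ^ n) = 0] (rmod p)"
  proof (rule reflected_harmonic_sum_cong_0[OF assms(1) \<open>odd p\<close>])
    fix k assume "k \<in> {k. k \<in> {0..p - 1} \<and> even k}"
    then show "[int (fib (p - 1 - k)) = - int (fib k)] (mod int p)"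
      using fib_reflect[OF F1, of k] by simp
  qed (use \<open>odd p\<close> in auto)
  moreover have "[(\<Sum>k | k \<in> {0..p - 1} \<and> odd k. of_nat (lucas k) * harmonic k ^ n) = 0] (rmod p)"
  proof (rule reflected_harmonic_sum_cong_0[OF assms(1) \<open>odd p\<close>])
    fix k assume "k \<in> {k. k \<in> {0..p - 1} \<and> odd k}"
    then show "[int (lucas (p - 1 - k)) = - int (lucas k)] (mod int p)"
      using lucas_reflect_odd[OF F1, of k] by simp
  qed (use \<open>odd p\<close> \<open>p > 1\<close> in auto)
  ultimately show ?thesis
    by (meson rat_cong_sym rat_cong_trans)
qed

end
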